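(* Let $G=(V,w,\mu,d)$ be a finite connected weighted graph equipped with a general path distance $d$ and having non-negative Ollivier curvature. Then $\beta_1(M_2(G))\le \frac{\deg_{\min}}{2}$.
   Context: A finite weighted graph $G=(V,w,\mu,d)$ consists of a finite vertex set $V$, a symmetric edge weight $w:V\times V\to[0,\infty)$ vanishing on the diagonal, a vertex weight $\mu:V\to(0,\infty)$, and a general path distance $d$. Write $x\sim y$ iff $w(x,y)>0$; $G$ is connected. A general path distance is a symmetric $d:V\times V\to[0,\infty)$ with $d(x,y)=0$ iff $x=y$ and $d(x,y)=\inf\{\sum_{k=1}^n d(x_{k-1},x_k): x=x_0\sim x_1\sim\dots\sim x_n=y\}$. $\deg(x)=|\{y:y\sim x\}|$ and $\deg_{\min}=\min_{x\in V}\deg(x)$. The Laplacian is $\Delta f(x)=\sum_{y}\frac{w(x,y)}{\mu(x)}(f(y)-f(x))$. For $x\neq y$ let $\nabla_{xy}f=\frac{f(x)-f(y)}{d(x,y)}$ and $\|\nabla f\|_\infty=\sup_{x\neq y}|\nabla_{xy}f|$. The Ollivier curvature of distinct $x,y$ is $\kappa(x,y)=\inf\{\nabla_{xy}\Delta f: \nabla_{yx}f=1,\ \|\nabla f\|_\infty=1\}$; non-negative Ollivier curvature means $\kappa(x,y)\ge0$ for all $x\sim y$. The complex $M_2(G)$: a 1-form is a function $\alpha$ on ordered pairs of adjacent vertices with $\alpha(y,x)=-\alpha(x,y)$. A cycle is a sequence $(x_0\sim\dots\sim x_{n-1})$ of distinct vertices with $n\ge3$, $x_{n-1}\sim x_0$,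 up to cyclic rotation and reversal. $X_2$ is the set of cycles admitting a labeling with either $n=3$, or $d(x_0,x_3)<d(x_0,x_1)+d(x_1,x_2)+d(x_2,x_3)$ and $x_3\sim x_4\sim\dots\sim x_{n-1}\sim x_0$ a geodesic (sum of $d$ along it equals $d(x_3,x_0)$). $\delta\alpha(c)=\sum_{i=0}^{n-1}\alpha(x_i,x_{i+1\bmod n})$ for $c\in X_2$; $\delta^*\alpha(x)=\sum_{y\sim x}\frac{w(x,y)}{\mu(x)}\alpha(x,y)$. $H_1(M_2(G))=\{\alpha:\delta\alpha=0\text{ on }X_2,\ \delta^*\alpha\equiv0\}$, $\beta_1(M_2(G))=\dim H_1(M_2(G))$. *)

theory Defs
  imports "HOL-Analysis.Analysis"
begin

text \<open>The vertex set is the universe of a finite type \<open>'v\<close>.\<close>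

definition adj :: "('v \<Rightarrow> 'v \<Rightarrow> real) \<Rightarrow> 'v \<Rightarrow> 'v \<Rightarrow> bool" where
  "adj w x y \<longleftrightarrow> w x y > 0"

definition connected_graph :: "('v \<Rightarrow> 'v \<Rightarrow> real) \<Rightarrow> bool" where
  "connected_graph w \<longleftrightarrow> (\<forall>x y. (adj w)\<^sup>*\<^sup>* x y)"

text \<open>Walks of length \<open>n = 0\<close> are admitted, so that the infimum is \<open>0\<close> on the diagonal. For \<open>x \<noteq> y\<close>
  the set of lengths is nonempty as soon as the graph is connected.\<close>

definition walk_lengths ::
  "('v \<Rightarrow> 'v \<Rightarrow> real) \<Rightarrow> ('v \<Rightarrow> 'v \<Rightarrow> real) \<Rightarrow> 'v \<Rightarrow> 'v \<Rightarrow> real set" where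
  "walk_lengths w d x y =
     {\<Sum>k=1..n. d (p (k - 1)) (p k) | (n::nat) p.
        p 0 = x \<and> p n = y \<and> (\<forall>k\<in>{1..n}. adj w (p (k - 1)) (p k))}"

definition general_path_distance ::
  "('v \<Rightarrow> 'v \<Rightarrow> real) \<Rightarrow> ('v \<Rightarrow> 'v \<Rightarrow> real) \<Rightarrow> bool" where
  "general_path_distance w d \<longleftrightarrow>
     (\<forall>x y. d x y \<ge> 0) \<and>
     (\<forall>x y. d x y = d y x) \<and>
     (\<forall>x y. d x y = 0 \<longleftrightarrow> x = y) \<and>
     (\<forall>x y. d x y = Inf (walk_lengths w d x y))"

locale weighted_graph =
  fixes w :: "'v::finite \<Rightarrow> 'v \<Rightarrow> real" and \<mu> :: "'v \<Rightarrow> real" and d :: "'v \<Rightarrow> 'v \<Rightarrow> real"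
  assumes weight_nonneg: "w x y \<ge> 0"
    and weight_sym: "w x y = w y x"
    and weight_diag: "w x x = 0"
    and vertex_weight_pos: "\<mu> x > 0"
    and path_distance: "general_path_distance w d"

definition vertex_degree :: "('v::finite \<Rightarrow> 'v \<Rightarrow> real) \<Rightarrow> 'v \<Rightarrow> nat" where
  "vertex_degree w x = card {y. adj w y x}"

definition min_degree :: "('v::finite \<Rightarrow> 'v \<Rightarrow> real) \<Rightarrow> nat" where
  "min_degree w = Min (range (vertex_degree w))"

definition laplacian ::
  "('v::finite \<Rightarrow> 'v \<Rightarrow> real) \<Rightarrow> ('v \<Rightarrow> real) \<Rightarrow> ('v \<Rightarrow> real) \<Rightarrow> 'v \<Rightarrow> real" where
  "laplacian w \<mu> f x = (\<Sum>y\<in>UNIV. w x y / \<mu> x * (f y - f x))"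

definition grad :: "('v \<Rightarrow> 'v \<Rightarrow> real) \<Rightarrow> 'v \<Rightarrow> 'v \<Rightarrow> ('v \<Rightarrow> real) \<Rightarrow> real" where
  "grad d x y f = (f x - f y) / d x y"

definition grad_norm :: "('v \<Rightarrow> 'v \<Rightarrow> real) \<Rightarrow> ('v \<Rightarrow> real) \<Rightarrow> real" where
  "grad_norm d f = Sup {\<bar>grad d x y f\<bar> | x y. x \<noteq> y}"

definition ollivier_curvature ::
  "('v::finite \<Rightarrow> 'v \<Rightarrow> real) \<Rightarrow> ('v \<Rightarrow> real) \<Rightarrow> ('v \<Rightarrow> 'v \<Rightarrow> real) \<Rightarrow> 'v \<Rightarrow> 'v \<Rightarrow> real" where
  "ollivier_curvature w \<mu> d x y =
     Inf {grad d x y (laplacian w \<mu> f) | f. grad d y x f = 1 \<and> grad_norm d f = 1}"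

definition nonneg_ollivier_curvature ::
  "('v::finite \<Rightarrow> 'v \<Rightarrow> real) \<Rightarrow> ('v \<Rightarrow> real) \<Rightarrow> ('v \<Rightarrow> 'v \<Rightarrow> real) \<Rightarrow> bool" where
  "nonneg_ollivier_curvature w \<mu> d \<longleftrightarrow>
     (\<forall>x y. adj w x y \<longrightarrow> ollivier_curvature w \<mu> d x y \<ge> 0)"

text \<open>Functions on the ordered adjacent pairs are identified with vectors indexed by all ordered
  pairs whose components at non-adjacent pairs are \<open>0\<close>.\<close>

definition one_forms :: "('v::finite \<Rightarrow> 'v \<Rightarrow> real) \<Rightarrow> (real ^ ('v \<times> 'v)) set" where
  "one_forms w = {\<alpha>. (\<forall>x y. adj w x y \<longrightarrow> \<alpha> $ (y, x) = - \<alpha> $ (x, y)) \<and>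
                     (\<forall>x y. \<not> adj w x y \<longrightarrow> \<alpha> $ (x, y) = 0)}"

text \<open>A cycle is represented by any of its labelings, i.e. by a list of vertices; \<open>same_cycle\<close> relates
  the labelings of one cycle. The coboundary of a 1-form on a cycle depends on the labeling only
  through its sign.\<close>

definition is_cycle :: "('v \<Rightarrow> 'v \<Rightarrow> real) \<Rightarrow> 'v list \<Rightarrow> bool" where
  "is_cycle w c \<longleftrightarrow> length c \<ge> 3 \<and> distinct c \<and>
     (\<forall>i<length c. adj w (c ! i) (c ! (Suc i mod length c)))"

definition same_cycle :: "'v list \<Rightarrow> 'v list \<Rightarrow> bool" where
  "same_cycle c c' \<longleftrightarrow> (\<exists>k. c' = rotate k c \<or> c' = rotate k (rev c))"

definition admissible_labeling :: "('v \<Rightarrow> 'v \<Rightarrow> real) \<Rightarrow> 'v list \<Rightarrow> bool" where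
  "admissible_labeling d c \<longleftrightarrow> length c = 3 \<or>
     (length c \<ge> 4 \<and>
      d (c ! 0) (c ! 3) < d (c ! 0) (c ! 1) + d (c ! 1) (c ! 2) + d (c ! 2) (c ! 3) \<and>
      (\<Sum>i=3..<length c. d (c ! i) (c ! (Suc i mod length c))) = d (c ! 3) (c ! 0))"

definition X2 :: "('v \<Rightarrow> 'v \<Rightarrow> real) \<Rightarrow> ('v \<Rightarrow> 'v \<Rightarrow> real) \<Rightarrow> 'v list set" where
  "X2 w d = {c. is_cycle w c \<and> (\<exists>c'. same_cycle c c' \<and> admissible_labeling d c')}"

definition coboundary :: "real ^ ('v::finite \<times> 'v) \<Rightarrow> 'v list \<Rightarrow> real" where
  "coboundary \<alpha> c = (\<Sum>i<length c. \<alpha> $ (c ! i, c ! (Suc i mod length c)))"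

definition codifferential ::
  "('v::finite \<Rightarrow> 'v \<Rightarrow> real) \<Rightarrow> ('v \<Rightarrow> real) \<Rightarrow> real ^ ('v \<times> 'v) \<Rightarrow> 'v \<Rightarrow> real" where
  "codifferential w \<mu> \<alpha> x = (\<Sum>y | adj w y x. w x y / \<mu> x * \<alpha> $ (x, y))"

definition H1_M2 ::
  "('v::finite \<Rightarrow> 'v \<Rightarrow> real) \<Rightarrow> ('v \<Rightarrow> real) \<Rightarrow> ('v \<Rightarrow> 'v \<Rightarrow> real) \<Rightarrow> (real ^ ('v \<times> 'v)) set" where
  "H1_M2 w \<mu> d = {\<alpha> \<in> one_forms w.
     (\<forall>c\<in>X2 w d. coboundary \<alpha> c = 0) \<and> (\<forall>x. codifferential w \<mu> \<alpha> x = 0)}"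

definition betti1_M2 ::
  "('v::finite \<Rightarrow> 'v \<Rightarrow> real) \<Rightarrow> ('v \<Rightarrow> real) \<Rightarrow> ('v \<Rightarrow> 'v \<Rightarrow> real) \<Rightarrow> nat" where
  "betti1_M2 w \<mu> d = dim (H1_M2 w \<mu> d)"

end

theory Submission
  imports Defs
begin

text \<open>
  Let \<open>\<alpha>\<close> be a nonzero element of \<open>H\<^sub>1\<close>, scaled so that \<open>\<bar>\<alpha>\<bar> \<le> d\<close> on edges with equality somewhere, and
  call \<open>u \<rightarrow> v\<close> tight if \<open>\<alpha>(u,v) = d(u,v)\<close>. Since \<open>\<alpha>\<close> vanishes on the cycles of \<open>X\<^sub>2\<close>, near a tight edge
  \<open>x \<rightarrow> y\<close> it is the differential of a 1-Lipschitz function which is harmonic at \<open>x\<close> and \<open>y\<close>. Perturbing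
  this function by a small multiple of \<open>h\<close>, non-negative curvature yields \<open>\<Delta>h(x) \<le> \<Delta>h(y)\<close> for every \<open>h\<close>
  with \<open>h(v) - h(u) \<ge> c d(u,v)\<close> on tight edges and equality on \<open>x \<rightarrow> y\<close>.

  If there were no tight cycle, the length of the longest tight path ending at a vertex (\<open>c = 1\<close>) would
  be a nonconstant subharmonic function. Indicators of sets that are closed under tight edges (\<open>c = 0\<close>)
  then show that from every vertex a tight cycle can be reached. Applied to \<open>\<alpha>\<close> and \<open>-\<alpha>\<close>, this says that
  at every vertex \<open>x\<close> both the maximum and the minimum of \<open>\<alpha>(x,y) / d(x,y)\<close> over \<open>y\<close> have the same
  absolute value, namely the positive norm of \<open>\<alpha>\<close>. Hence the functionals \<open>\<alpha> \<mapsto> \<alpha>(x,y) / d(x,y)\<close> span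
  a symmetric polytope in the dual of \<open>H\<^sub>1\<close> that has full dimension, and such a polytope has at least
  \<open>2 dim H\<^sub>1\<close> vertices.
\<close>

section \<open>Symmetric polytopes\<close>

lemma extreme_point_of_uminus:
  fixes P :: "'a::real_vector set"
  assumes "x extreme_point_of P" "\<And>v. v \<in> P \<Longrightarrow> - v \<in> P"
  shows "(- x) extreme_point_of P"
  unfolding extreme_point_of_def
proof (intro conjI ballI notI)
  show "- x \<in> P" using assms by (simp add: extreme_point_of_def)
  fix a b assume ab: "a \<in> P" "b \<in> P" "- x \<in> open_segment a b"
  then obtain t where t: "a \<noteq> b" "0 < t" "t < 1" "- x = (1 - t) *\<^sub>R a + t *\<^sub>R b"
    by (auto simp: in_segment)
  have "x = (1 - t) *\<^sub>R (- a) + t *\<^sub>R (- b)" using arg_cong[OF t(4), of uminus] by simp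
  then have "x \<in> open_segment (- a) (- b)" using t(1-3) by (auto simp: in_segment)
  then show False using assms ab(1,2) unfolding extreme_point_of_def by blast
qed

text \<open>The orthogonal projections of the vectors \<open>r i\<close> to \<open>S\<close> span a polytope that is symmetric about the
  origin, and its vertices come in antipodal pairs.\<close>

lemma dim_le_half_of_symmetric_functionals:
  fixes S :: "'a::euclidean_space set" and r :: "'i \<Rightarrow> 'a"
  assumes S: "subspace S" and N: "finite N"
    and sym: "\<And>a. a \<in> S \<Longrightarrow> a \<noteq> 0 \<Longrightarrow> \<exists>M>0. (\<forall>i\<in>N. \<bar>r i \<bullet> a\<bar> \<le> M) \<and>
      (\<exists>i\<in>N. r i \<bullet> a = M) \<and> (\<exists>i\<in>N. r i \<bullet> a = - M)"
  shows "2 * dim S \<le> card N"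
proof -
  have "\<exists>y\<in>S. \<forall>a\<in>S. v \<bullet> a = y \<bullet> a" for v
  proof -
    obtain y z where yz: "y \<in> span S" "\<And>u. u \<in> span S \<Longrightarrow> orthogonal z u" "v = y + z"
      using orthogonal_subspace_decomp_exists[of S v] by metis
    then show ?thesis
      using S by (auto simp: span_eq_iff[THEN iffD2] orthogonal_def inner_add_left intro!: bexI[of _ y])
  qed
  then obtain \<pi> where \<pi>: "\<And>v. \<pi> v \<in> S" "\<And>v a. a \<in> S \<Longrightarrow> v \<bullet> a = \<pi> v \<bullet> a" by metis
  define R where "R = (\<lambda>i. \<pi> (r i)) ` N"
  define P where "P = convex hull R"
  define E where "E = {x. x extreme_point_of P}"
  have R: "finite R" "R \<subseteq> S" "card R \<le> card N" using N \<pi>(1) by (auto simp: R_def card_image_le)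
  have R_P: "R \<subseteq> P" unfolding P_def by (rule hull_subset)
  have compact: "compact P" "convex P"
    using R(1) by (auto simp: P_def finite_imp_compact_convex_hull)
  \<comment> \<open>The normal \<open>a\<close> of a hyperplane separating \<open>- v\<close> from
    \<open>P\<close> acts on \<open>S\<close> like its projection \<open>\<pi> a\<close>. Some
    \<open>r j\<close> takes the value \<open>- M\<close> there, so \<open>b < - M\<close>, whereas
    \<open>v \<bullet> \<pi> a \<le> M\<close> puts \<open>- v\<close> on the same side as
    \<open>P\<close>.\<close>
  have neg_R: "- v \<in> P" if v: "v \<in> R" for v
  proof (rule ccontr)
    assume "- v \<notin> P"
    then obtain a b where ab: "a \<bullet> (- v) < b" "\<And>x. x \<in> P \<Longrightarrow> a \<bullet> x > b"
      using separating_hyperplane_closed_point[of P "- v"] compact compact_imp_closed by blast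
    have \<pi>a: "a \<bullet> x = x \<bullet> \<pi> a" if "x \<in> S" for x using \<pi>(2)[OF that, of a] by (simp add: inner_commute)
    have "v \<in> S" "v \<in> P" using v R R_P by auto
    then have sep: "- (v \<bullet> \<pi> a) < b" "b < v \<bullet> \<pi> a" using ab \<pi>a[OF \<open>v \<in> S\<close>] ab(2)[OF \<open>v \<in> P\<close>] by auto
    then have "\<pi> a \<noteq> 0" by auto
    with sym[OF \<pi>(1)] obtain M where M: "\<forall>i\<in>N. \<bar>r i \<bullet> \<pi> a\<bar> \<le> M" "\<exists>i\<in>N. r i \<bullet> \<pi> a = - M" by metis
    then obtain j where j: "j \<in> N" "r j \<bullet> \<pi> a = - M" by blast
    obtain i where i: "i \<in> N" "v = \<pi> (r i)" using v by (auto simp: R_def)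
    have "v \<bullet> \<pi> a \<le> M" using M(1) i \<pi>(2)[OF \<pi>(1), of "r i"] by (auto simp: abs_le_iff)
    moreover have "b < - M"
    proof -
      have "\<pi> (r j) \<in> P" using j R_P by (auto simp: R_def)
      then have "b < \<pi> (r j) \<bullet> \<pi> a" using ab(2) \<pi>a[OF \<pi>(1)] by metis
      then show ?thesis using \<pi>(2)[OF \<pi>(1), of "r j"] j(2) by metis
    qed
    ultimately show False using sep by simp
  qed
  have neg_P: "- v \<in> P" if "v \<in> P" for v
  proof -
    have "R \<subseteq> uminus ` P" using neg_R by (metis image_eqI minus_minus subsetI)
    moreover have "convex (uminus ` P)" using compact(2) by (rule convex_negations)
    ultimately have "P \<subseteq> uminus ` P" unfolding P_def by (rule hull_minimal)
    then show ?thesis using that by force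
  qed
  have E_R: "E \<subseteq> R" unfolding E_def P_def by (rule extreme_points_of_convex_hull)
  have "P = convex hull E" unfolding E_def using compact by (rule Krein_Milman_Minkowski)
  then have P_span: "P \<subseteq> span E" using convex_hull_subset_span by blast
  \<comment> \<open>The part \<open>z\<close> of \<open>a\<close> orthogonal to
    \<open>span E\<close> lies in \<open>S\<close> and is annihilated by every \<open>r i\<close>,
    against the positive maximum granted by \<open>sym\<close>.\<close>
  have S_span: "S \<subseteq> span E"
  proof
    fix a assume a: "a \<in> S"
    obtain y z where yz: "y \<in> span E" "\<And>u. u \<in> span E \<Longrightarrow> orthogonal z u" "a = y + z"
      using orthogonal_subspace_decomp_exists[of E a] by metis
    have "span E \<subseteq> S" using E_R R(2) S by (intro span_minimal) auto
    then have "z \<in> S" using yz(1,3) a S subspace_diff[of S a y] by auto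
    have "z = 0"
    proof (rule ccontr)
      assume "z \<noteq> 0"
      then obtain M i where "M > 0" "i \<in> N" "r i \<bullet> z = M" using sym[OF \<open>z \<in> S\<close>] by metis
      moreover have "\<pi> (r i) \<in> span E" using \<open>i \<in> N\<close> R_P P_span by (auto simp: R_def)
      then have "\<pi> (r i) \<bullet> z = 0" using yz(2) by (metis orthogonal_def inner_commute)
      ultimately show False using \<pi>(2)[OF \<open>z \<in> S\<close>, of "r i"] by simp
    qed
    then show "a \<in> span E" using yz by simp
  qed
  \<comment> \<open>A basis chosen among the vertices contains no antipodal pair, so
    \<open>B\<close> and its negatives form at least \<open>2 * dim S\<close> distinct
    vertices.\<close>
  obtain B where B: "B \<subseteq> E" "independent B" "E \<subseteq> span B" "card B = dim E"
    using basis_exists by blast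
  have "B \<inter> uminus ` B = {}"
  proof (rule ccontr)
    assume "B \<inter> uminus ` B \<noteq> {}"
    then obtain v where v: "v \<in> B" "- v \<in> B" by auto
    have "v \<noteq> 0" using v(1) B(2) dependent_zero by blast
    then have "v \<noteq> - v" by (simp add: eq_neg_iff_add_eq_0 scaleR_2[symmetric])
    then have "v \<in> span (B - {v})"
      using v span_neg[of "- v" "B - {v}"] span_base[of "- v" "B - {v}"] by auto
    then show False using v(1) B(2) by (auto simp: dependent_def)
  qed
  moreover have "finite B" using B(1) E_R R(1) by (meson finite_subset)
  ultimately have "card (B \<union> uminus ` B) = 2 * card B"
    by (simp add: card_Un_disjoint card_image)
  moreover have "B \<union> uminus ` B \<subseteq> E"
    using B(1) extreme_point_of_uminus[OF _ neg_P] by (auto simp: E_def)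
  then have "card (B \<union> uminus ` B) \<le> card R" using E_R R(1) by (intro card_mono) auto
  moreover have "dim S \<le> card B"
    using S_span B(4) dim_subset[of S "span E"] by (simp add: dim_span)
  ultimately show ?thesis using R(3) by linarith
qed

section \<open>Walks, cycles and geodesics\<close>

text \<open>Generic in the edge function, so that it measures lengths (\<open>d\<close>) as well as
  increments of forms. Closing a cycle up as \<open>c @ [hd c]\<close> replaces cyclic
  indices.\<close>

fun path_sum :: "('a \<Rightarrow> 'a \<Rightarrow> real) \<Rightarrow> 'a list \<Rightarrow> real" where
  "path_sum g (a # b # p) = g a b + path_sum g (b # p)"
| "path_sum g _ = 0"

lemma path_sum_conv_sum: "path_sum g p = (\<Sum>i<length p - 1. g (p ! i) (p ! Suc i))"
proof (induction g p rule: path_sum.induct)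
  case (1 g a b p)
  have "(\<Sum>i<length (a # b # p) - 1. g ((a # b # p) ! i) ((a # b # p) ! Suc i))
      = (\<Sum>i<Suc (length (b # p) - 1). g ((a # b # p) ! i) ((a # b # p) ! Suc i))"
    by simp
  also have "\<dots> = g a b + path_sum g (b # p)"
    unfolding sum.lessThan_Suc_shift 1 by simp
  finally show ?case by simp
qed auto

lemma nth_Suc_mod_length:
  assumes "i < length c"
  shows "c ! (Suc i mod length c) = (c @ [hd c]) ! Suc i"
proof (cases "Suc i = length c")
  case True
  then have "Suc i mod length c = 0" by simp
  moreover have "c \<noteq> []" using assms by auto
  ultimately show ?thesis using True by (simp add: nth_append hd_conv_nth)
next
  case False
  then show ?thesis using assms by (simp add: nth_append)
qed

lemma coboundary_eq_path_sum:
  "coboundary \<alpha> c = path_sum (\<lambda>u v. \<alpha> $ (u, v)) (c @ [hd c])"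
  unfolding coboundary_def path_sum_conv_sum
  by (intro sum.cong) (auto simp: nth_Suc_mod_length nth_append)

lemma is_cycleI:
  assumes "length c \<ge> 3" "distinct c" "successively (adj w) (c @ [hd c])"
  shows "is_cycle w c"
proof -
  have "adj w (c ! i) (c ! (Suc i mod length c))" if "i < length c" for i
  proof -
    have "adj w ((c @ [hd c]) ! i) ((c @ [hd c]) ! Suc i)"
      using assms(3) that unfolding successively_conv_nth by simp
    then show ?thesis using that by (simp add: nth_Suc_mod_length nth_append)
  qed
  then show ?thesis using assms by (simp add: is_cycle_def)
qed

text \<open>The list \<open>q\<close> holds the cycle from its fourth vertex on, so
  \<open>q @ [x0]\<close> is the part that has to be a geodesic.\<close>

lemma admissible_labelingI:
  assumes "q \<noteq> []" "d x0 (hd q) < d x0 x1 + d x1 x2 + d x2 (hd q)"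
    and "path_sum d (q @ [x0]) = d (hd q) x0"
  shows "admissible_labeling d (x0 # x1 # x2 # q)"
proof -
  define c where "c = x0 # x1 # x2 # q"
  define p where "p = c @ [hd c]"
  have p_nth: "p ! (i + 3) = (q @ [x0]) ! i" for i
    by (simp add: p_def c_def eval_nat_numeral)
  have length_c: "length c = length q + 3" by (simp add: c_def)
  have "(\<Sum>i=3..<length c. d (c ! i) (c ! (Suc i mod length c)))
      = (\<Sum>i=0 + 3..<length q + 3. d (p ! i) (p ! Suc i))"
    unfolding length_c[symmetric]
    by (intro sum.cong) (auto simp: nth_Suc_mod_length p_def nth_append)
  also have "\<dots> = (\<Sum>i<length q. d (p ! (i + 3)) (p ! (Suc i + 3)))"
    unfolding sum.shift_bounds_nat_ivl by (simp add: atLeast0LessThan)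
  also have "\<dots> = path_sum d (q @ [x0])"
    by (simp only: p_nth path_sum_conv_sum) simp
  finally have "(\<Sum>i=3..<length c. d (c ! i) (c ! (Suc i mod length c))) = d (hd q) x0"
    using assms(3) by simp
  moreover have "c ! 0 = x0" "c ! 1 = x1" "c ! 2 = x2" "c ! 3 = hd q"
    using assms(1) by (simp_all add: c_def eval_nat_numeral hd_conv_nth)
  moreover have "length c \<ge> 4" using assms(1) length_c by (cases q) auto
  ultimately have "admissible_labeling d c"
    unfolding admissible_labeling_def using assms(2) by simp
  then show ?thesis by (simp add: c_def)
qed

text \<open>Packages the condition on \<open>X2\<close> for later use: \<open>q = []\<close> is a
  triangle, and otherwise \<open>q @ [x0]\<close> is the geodesic back to \<open>x0\<close>.\<close>

lemma H1_M2_path_sum_eq_0: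
  assumes "\<alpha> \<in> H1_M2 w \<mu> d"
    and "distinct (x0 # x1 # x2 # q)" "successively (adj w) (x0 # x1 # x2 # q @ [x0])"
    and "q = [] \<or> d x0 (hd q) < d x0 x1 + d x1 x2 + d x2 (hd q) \<and> path_sum d (q @ [x0]) = d (hd q) x0"
  shows "path_sum (\<lambda>u v. \<alpha> $ (u, v)) (x0 # x1 # x2 # q @ [x0]) = 0"
proof -
  let ?c = "x0 # x1 # x2 # q"
  have "is_cycle w ?c" using assms(2,3) by (intro is_cycleI) auto
  moreover have "admissible_labeling d ?c"
  proof (cases "q = []")
    case True then show ?thesis by (simp add: admissible_labeling_def)
  next
    case False then show ?thesis using assms(4) by (intro admissible_labelingI) auto
  qed
  moreover have "same_cycle ?c ?c" unfolding same_cycle_def by (metis rotate0 id_apply)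
  ultimately have "?c \<in> X2 w d" unfolding X2_def by blast
  then have "coboundary \<alpha> ?c = 0" using assms(1) by (auto simp: H1_M2_def)
  then show ?thesis by (simp add: coboundary_eq_path_sum)
qed

lemma subspace_H1_M2: "subspace (H1_M2 w \<mu> d)"
proof -
  have "codifferential w \<mu> (\<alpha> + \<beta>) x = codifferential w \<mu> \<alpha> x + codifferential w \<mu> \<beta> x" for \<alpha> \<beta> x
    by (simp add: codifferential_def sum.distrib distrib_left)
  moreover have "codifferential w \<mu> (r *\<^sub>R \<alpha>) x = r * codifferential w \<mu> \<alpha> x" for r \<alpha> x
    by (simp add: codifferential_def sum_distrib_left mult.left_commute)
  moreover have "codifferential w \<mu> 0 x = 0" for x
    by (simp add: codifferential_def)
  ultimately show ?thesis
    unfolding subspace_def H1_M2_def one_forms_def coboundary_def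
    by (simp add: sum.distrib sum_distrib_left[symmetric])
qed

section \<open>Walks decomposed at their first edge\<close>

lemma zero_mem_walk_lengths: "0 \<in> walk_lengths w d u u"
  unfolding walk_lengths_def by (auto intro!: exI[of _ 0] exI[of _ "\<lambda>_. u"])

lemma Cons_mem_walk_lengths:
  assumes "adj w u v" "l \<in> walk_lengths w d v z"
  shows "d u v + l \<in> walk_lengths w d u z"
proof -
  obtain n :: nat and p where p: "l = (\<Sum>k=1..n. d (p (k - 1)) (p k))" "p 0 = v" "p n = z"
    "\<forall>k\<in>{1..n}. adj w (p (k - 1)) (p k)"
    using assms(2) unfolding walk_lengths_def by blast
  define q where "q = case_nat u p"
  have "(\<Sum>k=1..Suc n. d (q (k - 1)) (q k)) = d u v + (\<Sum>k=Suc 1..Suc n. d (q (k - 1)) (q k))"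
    by (subst sum.atLeast_Suc_atMost) (auto simp: q_def p(2))
  also have "(\<Sum>k=Suc 1..Suc n. d (q (k - 1)) (q k)) = (\<Sum>k=1..n. d (p (k - 1)) (p k))"
    unfolding sum.shift_bounds_cl_Suc_ivl
    by (intro sum.cong) (auto simp: q_def split: nat.split)
  finally have "d u v + l = (\<Sum>k=1..Suc n. d (q (k - 1)) (q k))" by (simp add: p(1))
  moreover have "\<forall>k\<in>{1..Suc n}. adj w (q (k - 1)) (q k)"
  proof
    fix k assume k: "k \<in> {1..Suc n}"
    then obtain j where j: "k = Suc j" by (cases k) auto
    show "adj w (q (k - 1)) (q k)"
    proof (cases j)
      case 0 then show ?thesis using assms(1) p(2) by (simp add: j q_def)
    next
      case (Suc i) then show ?thesis using p(4) k by (auto simp: j q_def dest: bspec[of _ _ "Suc i"])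
    qed
  qed
  moreover have "q 0 = u" "q (Suc n) = z" by (simp_all add: q_def p(3))
  ultimately show ?thesis unfolding walk_lengths_def by blast
qed

lemma walk_lengths_cases:
  assumes "l \<in> walk_lengths w d u z"
  obtains "u = z" "l = 0"
  | v l' where "adj w u v" "l' \<in> walk_lengths w d v z" "l = d u v + l'"
proof -
  obtain n :: nat and p where p: "l = (\<Sum>k=1..n. d (p (k - 1)) (p k))" "p 0 = u" "p n = z"
    "\<forall>k\<in>{1..n}. adj w (p (k - 1)) (p k)"
    using assms unfolding walk_lengths_def by blast
  show thesis
  proof (cases n)
    case 0 then show thesis using p that(1) by simp
  next
    case (Suc m)
    let ?l' = "\<Sum>k=1..m. d (p (Suc (k - 1))) (p (Suc k))"
    have "l = d u (p 1) + (\<Sum>k=Suc 1..Suc m. d (p (k - 1)) (p k))"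
      unfolding p(1) Suc by (subst sum.atLeast_Suc_atMost) (auto simp: p(2))
    also have "(\<Sum>k=Suc 1..Suc m. d (p (k - 1)) (p k)) = ?l'"
      unfolding sum.shift_bounds_cl_Suc_ivl by (intro sum.cong) auto
    finally have "l = d u (p 1) + ?l'" .
    moreover have "adj w (p (Suc (k - 1))) (p (Suc k))" if "k \<in> {1..m}" for k
      using p(4)[rule_format, of "Suc k"] that by (simp add: Suc)
    then have "?l' \<in> walk_lengths w d (p 1) z"
      unfolding walk_lengths_def using p(3) Suc
      by (auto intro!: exI[of _ m] exI[of _ "\<lambda>k. p (Suc k)"])
    moreover have "adj w u (p 1)" using p(2) p(4)[rule_format, of 1] Suc by simp
    ultimately show thesis using that(2) by blast
  qed
qed

section \<open>The path distance as a metric with geodesics\<close>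

lemma (in weighted_graph) adj_sym: "adj w u v \<Longrightarrow> adj w v u"
  by (simp add: adj_def weight_sym)

lemma (in weighted_graph) adj_irrefl: "\<not> adj w u u"
  by (simp add: adj_def weight_diag)

lemma (in weighted_graph) d_nonneg: "d u v \<ge> 0"
  and d_sym: "d u v = d v u"
  and d_eq_0_iff: "d u v = 0 \<longleftrightarrow> u = v"
  and d_eq_Inf: "d u v = Inf (walk_lengths w d u v)"
  using path_distance unfolding general_path_distance_def by blast+

lemma (in weighted_graph) d_pos: "u \<noteq> v \<Longrightarrow> d u v > 0"
  using d_nonneg[of u v] d_eq_0_iff[of u v] by linarith

lemma (in weighted_graph) d_self [simp]: "d u u = 0"
  using d_eq_0_iff by blast

lemma (in weighted_graph) walk_lengths_nonneg: "l \<in> walk_lengths w d u v \<Longrightarrow> l \<ge> 0"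
  unfolding walk_lengths_def by (auto intro!: sum_nonneg d_nonneg)

lemma (in weighted_graph) d_le_walk_length: "l \<in> walk_lengths w d u v \<Longrightarrow> d u v \<le> l"
  unfolding d_eq_Inf[of u v] by (intro cInf_lower bdd_belowI[of _ 0]) (auto intro: walk_lengths_nonneg)

lemma (in weighted_graph) codifferential_eq_sum_UNIV:
  assumes "\<alpha> \<in> one_forms w"
  shows "codifferential w \<mu> \<alpha> x = (\<Sum>y\<in>UNIV. w x y / \<mu> x * \<alpha> $ (x, y))"
proof -
  have "\<alpha> $ (x, y) = 0" if "\<not> adj w y x" for y
    using assms that adj_sym[of x y] by (auto simp: one_forms_def)
  then show ?thesis
    unfolding codifferential_def by (intro sum.mono_neutral_left) auto
qed

locale nonneg_curved_graph = weighted_graph w \<mu> d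
  for w :: "'v::finite \<Rightarrow> 'v \<Rightarrow> real" and \<mu> d +
  assumes connected: "connected_graph w"
    and nonneg_curvature: "nonneg_ollivier_curvature w \<mu> d"
begin

text \<open>Connectedness as an induction principle; it serves the maximum principle and the
  spreading of recurrence.\<close>

lemma adj_closed_eq_UNIV:
  assumes "S \<noteq> {}" "\<And>u v. u \<in> S \<Longrightarrow> adj w u v \<Longrightarrow> v \<in> S"
  shows "S = UNIV"
proof -
  obtain u where u: "u \<in> S" using assms(1) by blast
  have "v \<in> S" for v
  proof -
    have "(adj w)\<^sup>*\<^sup>* u v" using connected by (simp add: connected_graph_def)
    then show ?thesis by (induction rule: rtranclp_induct) (use u assms(2) in auto)
  qed
  then show ?thesis by blast
qed

lemma walk_lengths_nonempty: "walk_lengths w d u v \<noteq> {}"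
proof -
  have "(adj w)\<^sup>*\<^sup>* u v" using connected by (simp add: connected_graph_def)
  then show ?thesis
  proof (induction rule: converse_rtranclp_induct)
    case base
    then show ?case using zero_mem_walk_lengths by (metis empty_iff)
  next
    case (step y z)
    then show ?case using Cons_mem_walk_lengths by (metis all_not_in_conv)
  qed
qed

lemma d_triangle_adj:
  assumes "adj w u v"
  shows "d u z \<le> d u v + d v z"
proof -
  have "d u z - d u v \<le> Inf (walk_lengths w d v z)"
  proof (rule cInf_greatest[OF walk_lengths_nonempty])
    fix l assume "l \<in> walk_lengths w d v z"
    then have "d u z \<le> d u v + l"
      using assms by (intro d_le_walk_length Cons_mem_walk_lengths)
    then show "d u z - d u v \<le> l" by simp
  qed
  then show ?thesis using d_eq_Inf[of v z] by simp
qed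

text \<open>The infimum over walks is attained at the first edge: no walk from \<open>u\<close> to
  \<open>z\<close> is shorter than the minimum of \<open>d u v + d v z\<close> over the finitely
  many neighbours \<open>v\<close>.\<close>

lemma d_eq_via_neighbour:
  assumes "u \<noteq> z"
  obtains v where "adj w u v" "d u z = d u v + d v z"
proof -
  let ?N = "{v. adj w u v}"
  let ?D = "(\<lambda>v. d u v + d v z) ` ?N"
  obtain l where "l \<in> walk_lengths w d u z" using walk_lengths_nonempty by blast
  then have "?N \<noteq> {}" by (cases rule: walk_lengths_cases) (use assms in auto)
  then have "Min ?D \<in> ?D" by (intro Min_in) auto
  then obtain v where v: "adj w u v" "Min ?D = d u v + d v z" by auto
  have "Min ?D \<le> Inf (walk_lengths w d u z)"
  proof (rule cInf_greatest[OF walk_lengths_nonempty])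
    fix l assume "l \<in> walk_lengths w d u z"
    then show "Min ?D \<le> l"
    proof (cases rule: walk_lengths_cases)
      case (2 v' l')
      have "Min ?D \<le> d u v' + d v' z" using 2(1) by (intro Min_le) auto
      also have "\<dots> \<le> l" using d_le_walk_length[OF 2(2)] 2(3) by simp
      finally show ?thesis .
    qed (use assms in simp)
  qed
  then have "d u v + d v z \<le> d u z" using v(2) d_eq_Inf[of u z] by simp
  then show thesis using d_triangle_adj[OF v(1), of z] that v(1) by force
qed

lemma d_triangle: "d u z \<le> d u v + d v z"
proof -
  have "d u z \<le> l + d v z" if "l \<in> walk_lengths w d u v" for l
  proof -
    obtain n :: nat and p where p: "l = (\<Sum>k=1..n. d (p (k - 1)) (p k))" "p 0 = u" "p n = v"
      "\<forall>k\<in>{1..n}. adj w (p (k - 1)) (p k)"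
      using \<open>l \<in> walk_lengths w d u v\<close> unfolding walk_lengths_def by blast
    have "d u z \<le> (\<Sum>k=1..m. d (p (k - 1)) (p k)) + d (p m) z" if "m \<le> n" for m
      using that
    proof (induction m)
      case 0 then show ?case by (simp add: p(2))
    next
      case (Suc m)
      have "adj w (p m) (p (Suc m))" using p(4)[rule_format, of "Suc m"] Suc.prems by simp
      from d_triangle_adj[OF this, of z] show ?case using Suc by simp
    qed
    from this[of n] show ?thesis by (simp add: p(1,3))
  qed
  then have "d u z - d v z \<le> Inf (walk_lengths w d u v)"
    by (intro cInf_greatest[OF walk_lengths_nonempty]) (simp add: algebra_simps)
  then show ?thesis using d_eq_Inf[of u v] by simp
qed

text \<open>Induction on the number of vertices closer to \<open>z\<close>, as the next vertex of a
  geodesic is strictly closer. The last clause keeps \<open>u\<close> off the tail and later shows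
  that geodesics avoid given vertices.\<close>

lemma geodesic_exists:
  assumes "u \<noteq> z"
  shows "\<exists>q. q \<noteq> [] \<and> hd q = u \<and> successively (adj w) (q @ [z]) \<and> distinct (q @ [z]) \<and>
    path_sum d (q @ [z]) = d u z \<and> (\<forall>v\<in>set q. d u v + d v z = d u z)"
  using assms
proof (induction "card {v. d v z < d u z}" arbitrary: u rule: less_induct)
  case less
  obtain v where v: "adj w u v" "d u z = d u v + d v z"
    using d_eq_via_neighbour[OF less.prems] by blast
  then have "u \<noteq> v" using adj_irrefl by auto
  show ?case
  proof (cases "v = z")
    case True
    then show ?thesis using v less.prems by (intro exI[of _ "[u]"]) auto
  next
    case False
    have "d v z < d u z" using v(2) d_pos[OF \<open>u \<noteq> v\<close>] by simp
    then have "card {x. d x z < d v z} < card {x. d x z < d u z}"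
      by (intro psubset_card_mono) auto
    from less.hyps[OF this False] obtain q where q: "q \<noteq> []" "hd q = v"
      "successively (adj w) (q @ [z])" "distinct (q @ [z])" "path_sum d (q @ [z]) = d v z"
      "\<forall>x\<in>set q. d v x + d x z = d v z" by blast
    have "u \<notin> set q"
    proof
      assume "u \<in> set q"
      then have "d v u + d u z = d v z" using q(6) by blast
      then show False using \<open>d v z < d u z\<close> d_nonneg[of v u] by simp
    qed
    moreover have "d u x + d x z = d u z" if "x \<in> set q" for x
      using q(6)[rule_format, OF that] v(2) d_triangle[of u x v] d_triangle[of u z x] by linarith
    moreover obtain q' where q': "q = v # q'" using q(1,2) by (cases q) auto
    moreover have "successively (adj w) ((u # q) @ [z])" using q(3) v(1) q' by simp
    moreover have "path_sum d ((u # q) @ [z]) = d u z" using q(5) v(2) q' by simp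
    ultimately show ?thesis
      using q(4) less.prems by (intro exI[of _ "u # q"]) simp
  qed
qed

end

section \<open>Laplacians along tight edges\<close>

context nonneg_curved_graph
begin

text \<open>The function \<open>g\<close> competes in the infimum that defines the curvature. A real
  \<open>Inf\<close> is a lower bound only for sets bounded below, hence the preliminary bound on
  Laplacians.\<close>

lemma laplacian_le_of_lipschitz:
  assumes "adj w x y" and lip: "\<And>u v. g v - g u \<le> d u v" and tight: "g y - g x = d x y"
  shows "laplacian w \<mu> g y \<le> laplacian w \<mu> g x"
proof -
  let ?S = "{grad d x y (laplacian w \<mu> f) | f. grad d y x f = 1 \<and> grad_norm d f = 1}"
  have "x \<noteq> y" using assms(1) adj_irrefl by blast
  then have dxy: "d x y > 0" by (rule d_pos)
  have bdd: "bdd_above {\<bar>grad d u v f\<bar> | u v. u \<noteq> v}" for f :: "'v \<Rightarrow> real"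
  proof -
    have "{\<bar>grad d u v f\<bar> | u v. u \<noteq> v} \<subseteq> (\<lambda>(u, v). \<bar>grad d u v f\<bar>) ` UNIV" by auto
    then show ?thesis by (intro bdd_above_finite) (rule finite_subset, auto)
  qed
  have lap_bound: "\<bar>laplacian w \<mu> f u\<bar> \<le> (\<Sum>v\<in>UNIV. w u v / \<mu> u * d v u)"
    if "grad_norm d f = 1" for f u
    unfolding laplacian_def
  proof (rule order_trans[OF sum_abs], rule sum_mono)
    fix v
    have "\<bar>f v - f u\<bar> \<le> d v u"
    proof (cases "u = v")
      case False
      then have "\<bar>grad d v u f\<bar> \<le> grad_norm d f"
        unfolding grad_norm_def by (intro cSup_upper bdd) auto
      then show ?thesis using d_pos[of v u] False that by (simp add: grad_def field_simps)
    qed simp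
    then show "\<bar>w u v / \<mu> u * (f v - f u)\<bar> \<le> w u v / \<mu> u * d v u"
      using weight_nonneg[of u v] vertex_weight_pos[of u] by (simp add: abs_mult mult_left_mono divide_right_mono)
  qed
  define L where "L u = (\<Sum>v\<in>UNIV. w u v / \<mu> u * d v u)" for u
  have "bdd_below ?S"
  proof (rule bdd_belowI[of _ "- (L x + L y) / d x y"])
    fix t assume "t \<in> ?S"
    then obtain f where f: "t = grad d x y (laplacian w \<mu> f)" "grad_norm d f = 1" by blast
    have "- (L x + L y) \<le> laplacian w \<mu> f x - laplacian w \<mu> f y"
      using lap_bound[OF f(2), of x] lap_bound[OF f(2), of y] by (simp add: L_def)
    then show "- (L x + L y) / d x y \<le> t"
      using dxy unfolding f(1) grad_def by (intro divide_right_mono) auto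
  qed
  moreover have "grad_norm d g = 1"
    unfolding grad_norm_def
  proof (rule cSup_eq_maximum)
    show "1 \<in> {\<bar>grad d u v g\<bar> | u v. u \<noteq> v}"
    proof -
      have "\<bar>grad d y x g\<bar> = 1" using tight dxy by (simp add: grad_def d_sym[of y x])
      then show ?thesis using \<open>x \<noteq> y\<close> by (metis (mono_tags, lifting) mem_Collect_eq)
    qed
    fix t assume "t \<in> {\<bar>grad d u v g\<bar> | u v. u \<noteq> v}"
    then obtain u v where uv: "t = \<bar>grad d u v g\<bar>" "u \<noteq> v" by blast
    have "\<bar>g u - g v\<bar> \<le> d u v" using lip[of u v] lip[of v u] d_sym[of u v] by linarith
    then show "t \<le> 1" using d_pos[OF uv(2)] by (simp add: uv(1) grad_def)
  qed
  moreover have "grad d y x g = 1" using tight dxy by (simp add: grad_def d_sym[of y x])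
  ultimately have "ollivier_curvature w \<mu> d x y \<le> grad d x y (laplacian w \<mu> g)"
    unfolding ollivier_curvature_def by (intro cInf_lower) blast+
  moreover have "0 \<le> ollivier_curvature w \<mu> d x y"
    using nonneg_curvature assms(1) by (simp add: nonneg_ollivier_curvature_def)
  ultimately have "0 \<le> grad d x y (laplacian w \<mu> g)" by simp
  then show ?thesis using dxy by (simp add: grad_def zero_le_divide_iff)
qed

text \<open>A one-sided bound is enough: the reversed edge bounds
  \<open>- \<alpha> $ (u, v)\<close>.\<close>

definition lipschitz_harmonic :: "real ^ ('v \<times> 'v) \<Rightarrow> bool" where
  "lipschitz_harmonic \<alpha> \<longleftrightarrow> \<alpha> \<in> H1_M2 w \<mu> d \<and> (\<forall>u v. adj w u v \<longrightarrow> \<alpha> $ (u, v) \<le> d u v)"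

definition tight :: "real ^ ('v \<times> 'v) \<Rightarrow> 'v rel" where
  "tight \<alpha> = {(u, v). adj w u v \<and> \<alpha> $ (u, v) = d u v}"

lemma H1_M2_antisym: "\<alpha> \<in> H1_M2 w \<mu> d \<Longrightarrow> \<alpha> $ (v, u) = - \<alpha> $ (u, v)"
proof (cases "adj w u v")
  case False
  then have "\<not> adj w v u" using adj_sym by blast
  then show "\<alpha> \<in> H1_M2 w \<mu> d \<Longrightarrow> ?thesis" using False by (simp add: H1_M2_def one_forms_def)
qed (simp add: H1_M2_def one_forms_def)

lemma H1_M2_nonadj: "\<alpha> \<in> H1_M2 w \<mu> d \<Longrightarrow> \<not> adj w u v \<Longrightarrow> \<alpha> $ (u, v) = 0"
  by (auto simp: H1_M2_def one_forms_def)

lemma H1_M2_triangle: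
  assumes "\<alpha> \<in> H1_M2 w \<mu> d" "adj w u v" "adj w v z" "adj w z u"
  shows "\<alpha> $ (u, v) + \<alpha> $ (v, z) + \<alpha> $ (z, u) = 0"
proof -
  have "distinct [u, v, z]" using assms(2-4) adj_irrefl by auto
  then show ?thesis
    using H1_M2_path_sum_eq_0[OF assms(1), of u v z "[]"] assms(2-4) by simp
qed

section \<open>Increments along short paths compared with the distance\<close>

context
  fixes \<alpha> :: "real ^ ('v \<times> 'v)" and h :: "'v \<Rightarrow> real" and c :: real
  assumes \<alpha>: "lipschitz_harmonic \<alpha>"
    and h: "(u, v) \<in> tight \<alpha> \<Longrightarrow> c * d u v \<le> h v - h u"
begin

lemma \<alpha>_H1: "\<alpha> \<in> H1_M2 w \<mu> d"
  using \<alpha> by (simp add: lipschitz_harmonic_def)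

text \<open>Here \<open>s\<close> will be the increment of \<open>\<alpha>\<close> along some path from \<open>u\<close> to \<open>v\<close>.\<close>

definition dominated :: "'v \<Rightarrow> 'v \<Rightarrow> real \<Rightarrow> bool" where
  "dominated u v s \<longleftrightarrow> s \<le> d u v \<and> (s = d u v \<longrightarrow> c * d u v \<le> h v - h u)"

lemma dominated_edge: "adj w u v \<Longrightarrow> dominated u v (\<alpha> $ (u, v))"
  using \<alpha> h by (auto simp: dominated_def lipschitz_harmonic_def tight_def)

lemma dominated_add:
  assumes "dominated u v s" "dominated v z t" "d u z = d u v + d v z"
  shows "dominated u z (s + t)"
  using assms by (auto simp: dominated_def distrib_left)

text \<open>The minus sign reverses the path: vanishing on a cycle expresses an increment as minus
  the sum along the geodesic back. Equality of the sums forces equality on every edge.\<close>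

lemma dominated_path_sum:
  assumes "successively (adj w) p" "p \<noteq> []"
  shows "- path_sum (\<lambda>u v. \<alpha> $ (u, v)) p \<le> path_sum d p \<and>
    (- path_sum (\<lambda>u v. \<alpha> $ (u, v)) p = path_sum d p \<longrightarrow> c * path_sum d p \<le> h (hd p) - h (last p))"
  using assms
proof (induction p rule: induct_list012)
  case (3 a b p)
  have "dominated b a (\<alpha> $ (b, a))" using 3 adj_sym by (intro dominated_edge) simp
  then have "dominated b a (- \<alpha> $ (a, b))" using H1_M2_antisym[OF \<alpha>_H1, of b a] by simp
  then have ab: "- \<alpha> $ (a, b) \<le> d a b" "- \<alpha> $ (a, b) = d a b \<longrightarrow> c * d a b \<le> h a - h b"
    unfolding dominated_def d_sym[of b a] by auto
  have "successively (adj w) (b # p)" using 3(3) by simp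
  from 3(2)[OF this list.distinct(2)] ab show ?case
    unfolding path_sum.simps distrib_left list.sel last_ConsR[OF list.distinct(2)] by linarith
qed auto

text \<open>If the path is not a geodesic, a geodesic from \<open>e\<close> back to \<open>a\<close>
  avoids \<open>b\<close> and closes it to a cycle of \<open>X2\<close>, whose third labelled edge
  is the first edge of that geodesic (or to a triangle).\<close>

lemma dominated_two_path:
  assumes "adj w a b" "adj w b e"
  shows "dominated a e (\<alpha> $ (a, b) + \<alpha> $ (b, e))"
proof (cases "a = e")
  case True
  then show ?thesis using H1_M2_antisym[OF \<alpha>_H1, of e b] by (simp add: dominated_def)
next
  case False
  note ae = False
  show ?thesis
  proof (cases "d a e = d a b + d b e")
    case True
    then show ?thesis using assms dominated_edge dominated_add by blast
  next
    case False
    obtain q where q: "q \<noteq> []" "hd q = e" "successively (adj w) (q @ [a])" "distinct (q @ [a])"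
      "path_sum d (q @ [a]) = d e a" "\<forall>v\<in>set q. d e v + d v a = d e a"
      using geodesic_exists[of e a] ae by metis
    then obtain r where r: "q = e # r" by (cases q) auto
    have "b \<notin> set q"
      using q(6) False by (auto simp: d_sym[of a e] d_sym[of a b] d_sym[of b e])
    then have "distinct (a # b # e # r)" using q(4) r assms adj_irrefl by auto
    moreover have "successively (adj w) (a # b # e # r @ [a])" using q(3) r assms by simp
    moreover have "d a (hd r) < d a b + d b e + d e (hd r) \<and> path_sum d (r @ [a]) = d (hd r) a"
      if r_ne: "r \<noteq> []"
    proof -
      obtain g r' where r': "r = g # r'" using r_ne by (cases r) auto
      have "d e g + d g a = d e a" using q(6) r r' by simp
      moreover have "d a e < d a b + d b e" using False d_triangle[of a e b] by simp
      ultimately show ?thesis using q(5) r r' d_nonneg[of e g] by (simp add: d_sym[of a e] d_sym[of a g])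
    qed
    ultimately have "path_sum (\<lambda>u v. \<alpha> $ (u, v)) (a # b # e # r @ [a]) = 0"
      by (intro H1_M2_path_sum_eq_0[OF \<alpha>_H1]) auto
    then have "\<alpha> $ (a, b) + \<alpha> $ (b, e) = - path_sum (\<lambda>u v. \<alpha> $ (u, v)) (q @ [a])"
      by (simp add: r)
    moreover have "hd (q @ [a]) = e" using q(1,2) by simp
    ultimately show ?thesis
      using dominated_path_sum[OF q(3)] q(5) unfolding dominated_def by (simp add: d_sym[of a e])
  qed
qed

text \<open>If the distance splits at \<open>x\<close> or at \<open>y\<close>, an edge can be split
  off. Otherwise either \<open>x' = y'\<close> and the path is a triangle, or a geodesic from
  \<open>y'\<close> to \<open>x'\<close> avoids \<open>x\<close> and \<open>y\<close> and closes a
  cycle of \<open>X2\<close>.\<close>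

lemma dominated_three_path:
  assumes "adj w x' x" "adj w x y" "adj w y y'"
  shows "dominated x' y' (\<alpha> $ (x', x) + \<alpha> $ (x, y) + \<alpha> $ (y, y'))"
proof -
  consider "d x' y' = d x' x + d x y'" | "d x' y' = d x' y + d y y'" | "x' = y'" "x' \<noteq> x" "x' \<noteq> y"
    | "x' \<noteq> y'" "d x' y' \<noteq> d x' x + d x y'" "d x' y' \<noteq> d x' y + d y y'"
    by (cases "x' = y'"; cases "x' = x"; cases "x' = y") auto
  then show ?thesis
  proof cases
    case 1
    then have "dominated x' y' (\<alpha> $ (x', x) + (\<alpha> $ (x, y) + \<alpha> $ (y, y')))"
      using assms dominated_add dominated_edge dominated_two_path by blast
    then show ?thesis by (simp add: add.assoc)
  next
    case 2
    then show ?thesis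
      using assms dominated_add dominated_edge dominated_two_path by blast
  next
    case 3
    then show ?thesis using H1_M2_triangle[OF \<alpha>_H1 assms(1,2)] assms(3) by (simp add: dominated_def)
  next
    case 4
    obtain q where q: "q \<noteq> []" "hd q = y'" "successively (adj w) (q @ [x'])" "distinct (q @ [x'])"
      "path_sum d (q @ [x']) = d y' x'" "\<forall>v\<in>set q. d y' v + d v x' = d y' x'"
      using geodesic_exists[of y' x'] 4(1) by metis
    have "x \<notin> set q" "y \<notin> set q"
      using q(6) 4(2,3) by (auto simp: d_sym[of x' y'] d_sym[of x' x] d_sym[of x' y] d_sym[of x y'] d_sym[of y y'])
    moreover have "x' \<noteq> y" using 4(3) by auto
    ultimately have "distinct (x' # x # y # q)" using q(4) assms adj_irrefl by auto
    moreover have "successively (adj w) (x' # x # y # q @ [x'])"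
      using q(1-3) assms by (cases q) auto
    moreover have "d x' y' < d x' x + d x y + d y y'"
      using 4(2) d_triangle[of x' y' x] d_triangle[of x y' y] by linarith
    ultimately have "path_sum (\<lambda>u v. \<alpha> $ (u, v)) (x' # x # y # q @ [x']) = 0"
      using q(2,5) by (intro H1_M2_path_sum_eq_0[OF \<alpha>_H1]) auto
    then have "\<alpha> $ (x', x) + \<alpha> $ (x, y) + \<alpha> $ (y, y') = - path_sum (\<lambda>u v. \<alpha> $ (u, v)) (q @ [x'])"
      using q(1,2) by (cases q) auto
    moreover have "hd (q @ [x']) = y'" using q(1,2) by simp
    ultimately show ?thesis
      using dominated_path_sum[OF q(3)] q(5) unfolding dominated_def by (simp add: d_sym[of x' y'])
  qed
qed

text \<open>Equivalently, \<open>s - \<epsilon> * (h v - h u) \<le> (1 - \<epsilon> * c) * d u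
  v\<close>. A strict gap \<open>s < d u v\<close> absorbs any small perturbation; with equality the
  right-hand side of the claim is nonnegative.\<close>

lemma eventually_dominated:
  assumes "dominated u v s"
  shows "\<forall>\<^sub>F \<epsilon> in at_right 0. s - d u v \<le> \<epsilon> * (h v - h u - c * d u v)"
proof (cases "s = d u v")
  case True
  then have "0 \<le> h v - h u - c * d u v" using assms by (simp add: dominated_def)
  then show ?thesis using True
    by (auto simp: eventually_at_right_less intro: eventually_mono[OF eventually_at_right_less[of 0]])
next
  case False
  then have "s - d u v < 0" using assms by (simp add: dominated_def)
  moreover have "((\<lambda>\<epsilon>. \<epsilon> * (h v - h u - c * d u v)) \<longlongrightarrow> 0 * (h v - h u - c * d u v)) (at_right 0)"
    by (intro tendsto_intros)
  ultimately have "\<forall>\<^sub>F \<epsilon> in at_right 0. s - d u v < \<epsilon> * (h v - h u - c * d u v)"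
    by (intro order_tendstoD(1)) auto
  then show ?thesis by (rule eventually_mono) simp
qed

text \<open>Subtracting \<epsilon> times the differential of \<open>h\<close> from \<alpha> and
  dividing by \<open>1 - \<epsilon> * c\<close> preserves tightness of the edge and the Lipschitz
  bound between the neighbourhoods of \<open>x\<close> and \<open>y\<close>. As \<alpha> is
  coclosed, comparing Laplacians leaves only \<open>h\<close>.\<close>

lemma laplacian_le_along_tight:
  assumes "(x, y) \<in> tight \<alpha>" and hxy: "h y - h x = c * d x y"
  shows "laplacian w \<mu> h x \<le> laplacian w \<mu> h y"
proof -
  have xy: "adj w x y" "\<alpha> $ (x, y) = d x y" using assms(1) by (auto simp: tight_def)
  define X where "X = insert x {u. adj w x u}"
  define Y where "Y = insert y {v. adj w y v}"
  \<comment> \<open>The increment of \<alpha> along the path \<open>u\<close>, \<open>x\<close>,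
    \<open>y\<close>, \<open>v\<close>, which degenerates if \<open>u = x\<close> or
    \<open>v = y\<close>.\<close>
  define s where "s u v = d x y + \<alpha> $ (y, v) - \<alpha> $ (x, u)" for u v
  have self: "\<alpha> $ (u, u) = 0" for u using H1_M2_nonadj[OF \<alpha>_H1] adj_irrefl by blast
  have dom: "dominated u v (s u v)" if uv: "u \<in> X" "v \<in> Y" for u v
  proof -
    have s: "s u v = \<alpha> $ (u, x) + \<alpha> $ (x, y) + \<alpha> $ (y, v)"
      using H1_M2_antisym[OF \<alpha>_H1, of u x] by (simp add: s_def xy)
    consider "u = x" "v = y" | "u = x" "adj w y v" | "adj w x u" "v = y" | "adj w x u" "adj w y v"
      using uv by (auto simp: X_def Y_def)
    then show ?thesis
    proof cases
      case 1 then show ?thesis using dominated_edge[OF xy(1)] unfolding s by (simp add: self)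
    next
      case 2 then show ?thesis using dominated_two_path[OF xy(1)] unfolding s by (simp add: self)
    next
      case 3 then show ?thesis using dominated_two_path[OF adj_sym xy(1)] unfolding s by (simp add: self)
    next
      case 4 then show ?thesis using dominated_three_path[OF adj_sym xy(1)] unfolding s by (simp add: self)
    qed
  qed
  \<comment> \<open>There are finitely many pairs, so one \<epsilon> serves all of them.\<close>
  have "\<forall>\<^sub>F \<epsilon> in at_right 0. \<forall>u\<in>X. \<forall>v\<in>Y. s u v - d u v \<le> \<epsilon> * (h v - h u - c * d u v)"
    by (intro eventually_ball_finite ballI eventually_dominated dom) auto
  moreover have "((\<lambda>\<epsilon>. 1 - \<epsilon> * c) \<longlongrightarrow> 1 - 0 * c) (at_right 0)"
    by (intro tendsto_intros)
  then have "\<forall>\<^sub>F \<epsilon> in at_right 0. 1 - \<epsilon> * c > 0"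
    by (intro order_tendstoD(1)) auto
  ultimately have "\<forall>\<^sub>F \<epsilon> in at_right 0. \<epsilon> > 0 \<and> 1 - \<epsilon> * c > 0 \<and>
      (\<forall>u\<in>X. \<forall>v\<in>Y. s u v - d u v \<le> \<epsilon> * (h v - h u - c * d u v))"
    using eventually_at_right_less[of "0::real"] by eventually_elim auto
  then obtain \<epsilon> where \<epsilon>: "\<epsilon> > 0" "1 - \<epsilon> * c > 0"
    "\<And>u v. u \<in> X \<Longrightarrow> v \<in> Y \<Longrightarrow> s u v - d u v \<le> \<epsilon> * (h v - h u - c * d u v)"
    using eventually_happens'[OF trivial_limit_at_right_real] by (metis (no_types, lifting))
  define r where "r = 1 - \<epsilon> * c"
  have r: "r > 0" using \<epsilon>(2) by (simp add: r_def)
  define a where "a u = (\<alpha> $ (x, u) - \<epsilon> * h u) / r" for u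
  define b where "b v = (d x y + \<alpha> $ (y, v) - \<epsilon> * h v) / r" for v
  \<comment> \<open>\<open>a\<close> and \<open>b\<close> are the perturbed local potential of \<open>\<alpha>\<close> around \<open>x\<close> and around \<open>y\<close>; the Lipschitz
    extension \<open>G\<close> of \<open>a\<close> lies below \<open>a\<close> and above \<open>b\<close>, and touches them at \<open>x\<close> and \<open>y\<close>.\<close>
  define G where "G v = Min ((\<lambda>u. a u + d u v) ` X)" for v
  have X: "finite X" "x \<in> X" by (auto simp: X_def)
  have G_le: "G v \<le> a u + d u v" if "u \<in> X" for u v
    unfolding G_def using that X by (intro Min_le) auto
  have G_in: "\<exists>u\<in>X. G v = a u + d u v" for v
  proof -
    have "G v \<in> (\<lambda>u. a u + d u v) ` X" unfolding G_def using X by (intro Min_in) auto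
    then show ?thesis by blast
  qed
  have lip: "G v - G u \<le> d u v" for u v
  proof -
    obtain z where z: "z \<in> X" "G u = a z + d z u" using G_in by blast
    have "G v \<le> a z + d z v" using z(1) by (rule G_le)
    then show ?thesis using z(2) d_triangle[of z v u] by linarith
  qed
  have b_le: "b v \<le> G v" if v: "v \<in> Y" for v
  proof -
    obtain u where u: "u \<in> X" "G v = a u + d u v" using G_in by blast
    have "d x y + \<alpha> $ (y, v) - \<epsilon> * h v \<le> \<alpha> $ (x, u) - \<epsilon> * h u + d u v * r"
      using \<epsilon>(3)[OF u(1) v] by (simp add: s_def r_def algebra_simps)
    then have "b v \<le> (\<alpha> $ (x, u) - \<epsilon> * h u + d u v * r) / r"
      unfolding b_def using r by (intro divide_right_mono) auto
    also have "\<dots> = G v" using r by (simp add: u(2) a_def add_divide_distrib)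
    finally show ?thesis .
  qed
  have le_a: "G u \<le> a u" if "u \<in> X" for u using G_le[OF that, of u] by simp
  have "b y - a x = d x y"
  proof -
    have "h y = h x + c * d x y" using hxy by simp
    then have "d x y + \<alpha> $ (y, y) - \<epsilon> * h y - (\<alpha> $ (x, x) - \<epsilon> * h x) = d x y * r"
      by (simp add: self r_def algebra_simps)
    then show ?thesis using r unfolding a_def b_def diff_divide_distrib[symmetric] by simp
  qed
  \<comment> \<open>The chain \<open>d x y = b y - a x \<le> G y - G x \<le> d x y\<close> forces
    equality throughout.\<close>
  moreover have "b y \<le> G y" "G x \<le> a x" using b_le le_a by (auto simp: X_def Y_def)
  ultimately have G: "G x = a x" "G y = b y" "G y - G x = d x y"
    using lip[of y x] by linarith+
  have p: "w u v / \<mu> u \<ge> 0" for u v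
    using weight_nonneg[of u v] vertex_weight_pos[of u] by simp
  have codiff: "(\<Sum>v\<in>UNIV. w u v / \<mu> u * \<alpha> $ (u, v)) = 0" for u
    using \<alpha>_H1 codifferential_eq_sum_UNIV[of \<alpha> u] by (auto simp: H1_M2_def)
  have lap_split: "(\<Sum>v\<in>UNIV. w u v / \<mu> u * ((\<alpha> $ (u, v) - \<epsilon> * (h v - h u)) / r))
      = - \<epsilon> / r * laplacian w \<mu> h u" for u
  proof -
    have "P * ((A - \<epsilon> * H) / r) = P * A * (1 / r) - P * H * (\<epsilon> / r)" for P A H :: real
      by (simp add: diff_divide_distrib right_diff_distrib)
    then have "(\<Sum>v\<in>UNIV. w u v / \<mu> u * ((\<alpha> $ (u, v) - \<epsilon> * (h v - h u)) / r))
      = (\<Sum>v\<in>UNIV. w u v / \<mu> u * \<alpha> $ (u, v) * (1 / r) - w u v / \<mu> u * (h v - h u) * (\<epsilon> / r))"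
      by presburger
    also have "\<dots> = (\<Sum>v\<in>UNIV. w u v / \<mu> u * \<alpha> $ (u, v)) * (1 / r) - laplacian w \<mu> h u * (\<epsilon> / r)"
      unfolding laplacian_def sum_subtractf sum_distrib_right by (rule refl)
    also have "\<dots> = - \<epsilon> / r * laplacian w \<mu> h u"
      unfolding codiff by simp
    finally show ?thesis .
  qed
  have "laplacian w \<mu> G x \<le> (\<Sum>v\<in>UNIV. w x v / \<mu> x * ((\<alpha> $ (x, v) - \<epsilon> * (h v - h x)) / r))"
    unfolding laplacian_def
  proof (rule sum_mono)
    fix v
    show "w x v / \<mu> x * (G v - G x) \<le> w x v / \<mu> x * ((\<alpha> $ (x, v) - \<epsilon> * (h v - h x)) / r)"
    proof (cases "adj w x v")
      case True
      then have "G v - G x \<le> a v - a x" using le_a[of v] G(1) by (simp add: X_def)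
      also have "\<dots> = (\<alpha> $ (x, v) - \<epsilon> * (h v - h x)) / r"
        unfolding a_def diff_divide_distrib[symmetric] by (simp add: self algebra_simps)
      finally show ?thesis by (rule mult_left_mono[OF _ p])
    next
      case False
      then show ?thesis using weight_nonneg[of x v] by (simp add: adj_def)
    qed
  qed
  moreover have "(\<Sum>v\<in>UNIV. w y v / \<mu> y * ((\<alpha> $ (y, v) - \<epsilon> * (h v - h y)) / r)) \<le> laplacian w \<mu> G y"
    unfolding laplacian_def
  proof (rule sum_mono)
    fix v
    show "w y v / \<mu> y * ((\<alpha> $ (y, v) - \<epsilon> * (h v - h y)) / r) \<le> w y v / \<mu> y * (G v - G y)"
    proof (cases "adj w y v")
      case True
      have "(\<alpha> $ (y, v) - \<epsilon> * (h v - h y)) / r = b v - b y"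
        unfolding b_def diff_divide_distrib[symmetric] by (simp add: self algebra_simps)
      also have "\<dots> \<le> G v - G y" using True b_le[of v] G(2) by (simp add: Y_def)
      finally show ?thesis by (rule mult_left_mono[OF _ p])
    next
      case False
      then show ?thesis using weight_nonneg[of y v] by (simp add: adj_def)
    qed
  qed
  ultimately have "- \<epsilon> / r * laplacian w \<mu> h y \<le> - \<epsilon> / r * laplacian w \<mu> h x"
    using laplacian_le_of_lipschitz[OF xy(1) lip G(3)] unfolding lap_split by linarith
  \<comment> \<open>The negative factor reverses the inequality between the Laplacians.\<close>
  moreover have "- \<epsilon> / r < 0" using \<epsilon>(1) r by simp
  ultimately show ?thesis by (simp only: mult_le_cancel_left_neg)
qed

end

end

section \<open>Tight cycles\<close>

context nonneg_curved_graph
begin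

lemma tight_imp_pos: "(u, v) \<in> tight \<alpha> \<Longrightarrow> d u v > 0"
  using adj_irrefl by (auto simp: tight_def intro!: d_pos)

text \<open>Maximum principle: the set where the maximum is attained is closed under
  adjacency.\<close>

lemma subharmonic_imp_const:
  assumes "\<And>u. laplacian w \<mu> h u \<ge> 0"
  shows "h u = h v"
proof -
  define M where "M = Max (range h)"
  have le: "h z \<le> M" for z unfolding M_def by (intro Max_ge) auto
  have "M \<in> range h" unfolding M_def by (intro Max_in) auto
  have "{z. h z = M} = UNIV"
  proof (rule adj_closed_eq_UNIV)
    show "{z. h z = M} \<noteq> {}" using \<open>M \<in> range h\<close> by auto
    fix a b assume "a \<in> {z. h z = M}" and ab: "adj w a b"
    then have a: "h a = M" by simp
    have nonneg: "w a z / \<mu> a * (h a - h z) \<ge> 0" for z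
      using weight_nonneg[of a z] vertex_weight_pos[of a] le[of z] a by simp
    have "(\<Sum>z\<in>UNIV. w a z / \<mu> a * (h a - h z)) = - laplacian w \<mu> h a"
      unfolding laplacian_def sum_negf[symmetric] by (intro sum.cong refl) (simp add: right_diff_distrib)
    then have "(\<Sum>z\<in>UNIV. w a z / \<mu> a * (h a - h z)) \<le> 0" using assms[of a] by simp
    then have "(\<Sum>z\<in>UNIV. w a z / \<mu> a * (h a - h z)) = 0"
      by (intro antisym sum_nonneg) (use nonneg in auto)
    then have "w a b / \<mu> a * (h a - h b) = 0"
      using nonneg by (subst (asm) sum_nonneg_eq_0_iff) auto
    then show "b \<in> {z. h z = M}" using ab vertex_weight_pos[of a] a by (auto simp: adj_def)
  qed
  then show ?thesis by (metis UNIV_I mem_Collect_eq)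
qed

lemma tight_not_acyclic:
  assumes \<alpha>: "lipschitz_harmonic \<alpha>" and "tight \<alpha> \<noteq> {}"
  shows "\<not> acyclic (tight \<alpha>)"
proof
  assume "acyclic (tight \<alpha>)"
  then have wf: "wf (tight \<alpha>)" by (intro finite_acyclic_wf) auto
  \<comment> \<open>The \<open>0\<close> covers vertices without a tight predecessor and keeps the
    set nonempty. The fixed point \<open>h v\<close> is the length of a longest tight path ending at
    \<open>v\<close>.\<close>
  define F :: "('v \<Rightarrow> real) \<Rightarrow> 'v \<Rightarrow> real"
    where "F f v = Max (insert 0 ((\<lambda>u. f u + d u v) ` {u. (u, v) \<in> tight \<alpha>}))" for f v
  define h where "h = wfrec (tight \<alpha>) F"
  have h_eq: "h v = F h v" for v
  proof -
    have "h v = F (cut h (tight \<alpha>) v) v" unfolding h_def by (rule wfrec[OF wf])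
    also have "\<dots> = F h v"
      unfolding F_def by (intro arg_cong[of _ _ Max] arg_cong[of _ _ "insert 0"] image_cong) (auto simp: cut_apply)
    finally show ?thesis .
  qed
  have h_ge: "h u + d u v \<le> h v" if "(u, v) \<in> tight \<alpha>" for u v
    unfolding h_eq[of v] F_def using that by (intro Max_ge) auto
  have h_nonneg: "0 \<le> h v" for v
    unfolding h_eq[of v] F_def by (intro Max_ge) auto
  have h_cases: "h v = 0 \<or> (\<exists>u. (u, v) \<in> tight \<alpha> \<and> h v = h u + d u v)" for v
  proof -
    have "h v \<in> insert 0 ((\<lambda>u. h u + d u v) ` {u. (u, v) \<in> tight \<alpha>})"
      unfolding h_eq[of v] F_def by (intro Max_in) auto
    then show ?thesis by auto
  qed
  have "laplacian w \<mu> h v \<ge> 0" for v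
    using wf
  proof (induction v rule: wf_induct_rule)
    case (less v)
    show ?case
    proof (cases "h v = 0")
      case True
      \<comment> \<open>As \<open>h\<close> is nonnegative, it has a minimum at
        \<open>v\<close>.\<close>
      then show ?thesis
        unfolding laplacian_def using weight_nonneg vertex_weight_pos h_nonneg
        by (intro sum_nonneg mult_nonneg_nonneg divide_nonneg_pos) auto
    next
      case False
      then obtain u where u: "(u, v) \<in> tight \<alpha>" "h v = h u + d u v" using h_cases by blast
      have "laplacian w \<mu> h u \<le> laplacian w \<mu> h v"
        by (rule laplacian_le_along_tight[OF \<alpha>, of 1]) (use u h_ge in \<open>auto simp: algebra_simps\<close>)
      then show ?thesis using less[OF u(1)] by simp
    qed
  qed
  then have const: "h u = h v" for u v by (rule subharmonic_imp_const)
  obtain u v where uv: "(u, v) \<in> tight \<alpha>" using assms(2) by auto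
  show False using h_ge[OF uv] const[of u v] tight_imp_pos[OF uv] by simp
qed

text \<open>The number \<open>(\<Sum>z\<in>U. w x z / \<mu> x)\<close> is the Laplacian at \<open>x\<close> of the indicator function of \<open>U\<close>,
  which is nondecreasing along tight edges.\<close>

lemma upset_rate_mono:
  assumes \<alpha>: "lipschitz_harmonic \<alpha>"
    and up: "\<And>u v. (u, v) \<in> tight \<alpha> \<Longrightarrow> u \<in> U \<Longrightarrow> v \<in> U"
    and "(x, y) \<in> (tight \<alpha>)\<^sup>*" "y \<notin> U"
  shows "(\<Sum>z\<in>U. w x z / \<mu> x) \<le> (\<Sum>z\<in>U. w y z / \<mu> y)"
  using assms(3)
proof (induction rule: converse_rtrancl_induct)
  case (step u v)
  \<comment> \<open>Tight edges never leave \<open>U\<close>, so a tight path ending outside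
    \<open>U\<close> stays outside and the indicator vanishes along it.\<close>
  have notin: "v \<notin> U" if "(v, y) \<in> (tight \<alpha>)\<^sup>*" for v
    using that by (induction rule: converse_rtrancl_induct) (use assms(4) up in auto)
  have "v \<notin> U" "u \<notin> U" using step(1,2) notin by (meson converse_rtrancl_into_rtrancl)+
  have lap: "laplacian w \<mu> (indicator U) x = (\<Sum>z\<in>U. w x z / \<mu> x)" if "x \<notin> U" for x
  proof -
    have "laplacian w \<mu> (indicator U) x = (\<Sum>z\<in>UNIV. w x z / \<mu> x * indicator U z)"
      using that by (simp add: laplacian_def)
    also have "\<dots> = (\<Sum>z\<in>U. w x z / \<mu> x)"
      by (intro sum.mono_neutral_cong_right) auto
    finally show ?thesis .
  qed
  have "laplacian w \<mu> (indicator U) u \<le> laplacian w \<mu> (indicator U) v"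
    using \<open>u \<notin> U\<close> \<open>v \<notin> U\<close> up
    by (intro laplacian_le_along_tight[OF \<alpha> _ step(1), of 0]) (auto simp: indicator_def)
  then show ?case using step(3) lap \<open>u \<notin> U\<close> \<open>v \<notin> U\<close> by simp
qed simp

section \<open>Reachability of tight cycles\<close>

lemma rate_pos_iff: "0 < (\<Sum>z\<in>U. w x z / \<mu> x) \<longleftrightarrow> (\<exists>z\<in>U. adj w x z)"
proof -
  have "0 < w x z / \<mu> x \<longleftrightarrow> adj w x z" for z
    using vertex_weight_pos[of x] by (simp add: adj_def zero_less_divide_iff)
  moreover have nonneg: "0 \<le> w x z / \<mu> x" for z
    using weight_nonneg[of x z] vertex_weight_pos[of x] by simp
  moreover have "(\<Sum>z\<in>U. w x z / \<mu> x) = 0 \<longleftrightarrow> (\<forall>z\<in>U. w x z / \<mu> x = 0)"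
    using nonneg by (intro sum_nonneg_eq_0_iff) auto
  ultimately show ?thesis
    using sum_nonneg[of U "\<lambda>z. w x z / \<mu> x"] by (metis less_eq_real_def order_less_irrefl)
qed

text \<open>A member need not lie on a tight cycle itself. This makes the complement closed under
  tight edges, so that jump rates into it are monotone.\<close>

definition recurrent :: "real ^ ('v \<times> 'v) \<Rightarrow> 'v set" where
  "recurrent \<alpha> = {v. \<exists>e. (v, e) \<in> (tight \<alpha>)\<^sup>* \<and> (e, e) \<in> (tight \<alpha>)\<^sup>+}"

lemma recurrent_backward: "(u, v) \<in> (tight \<alpha>)\<^sup>* \<Longrightarrow> v \<in> recurrent \<alpha> \<Longrightarrow> u \<in> recurrent \<alpha>"
  unfolding recurrent_def by (auto intro: rtrancl_trans)

text \<open>A suitable nonrecurrent neighbour \<open>m\<close> would be adjacent to the whole strong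
  component \<open>C\<close> of \<open>e\<close>, and triangles with apex \<open>m\<close> would
  make \<alpha> grow forever around a cycle.\<close>

lemma neighbour_of_tight_cycle_recurrent:
  assumes \<alpha>: "lipschitz_harmonic \<alpha>" and e: "(e, e) \<in> (tight \<alpha>)\<^sup>+" and "adj w e z"
  shows "z \<in> recurrent \<alpha>"
proof (rule ccontr)
  assume "z \<notin> recurrent \<alpha>"
  let ?T = "tight \<alpha>"
  define C where "C = {x. (e, x) \<in> ?T\<^sup>* \<and> (x, e) \<in> ?T\<^sup>*}"
  define U where "U v = ?T\<^sup>* `` {v}" for v
  have C_rec: "C \<subseteq> recurrent \<alpha>" using e by (auto simp: C_def recurrent_def)
  define P where "P v \<longleftrightarrow> v \<notin> recurrent \<alpha> \<and> (\<exists>x\<in>C. adj w x v)" for v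
  have "P z" using \<open>z \<notin> recurrent \<alpha>\<close> assms(3) by (auto simp: P_def C_def)
  then obtain m where m: "P m" "\<And>v. P v \<Longrightarrow> card (U m) \<le> card (U v)"
    using ex_has_least_nat[of P z "\<lambda>v. card (U v)"] by blast
  have m_rec: "m \<notin> recurrent \<alpha>" using m(1) by (simp add: P_def)
  have U_rec: "v \<notin> recurrent \<alpha>" if "v \<in> U m" for v
    using that m_rec recurrent_backward by (auto simp: U_def)
  have U_up: "v \<in> U m" if "(u, v) \<in> ?T" "u \<in> U m" for u v
    using that by (auto simp: U_def)
  \<comment> \<open>By minimality the set of vertices above \<open>m\<close> meets the neighbourhood of the cycle only in \<open>m\<close>,
    and the rate of jumping into it is constant along the cycle.\<close>
  have only_m: "v = m" if v: "v \<in> U m" "x \<in> C" "adj w x v" for v x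
  proof (rule ccontr)
    assume "v \<noteq> m"
    have "P v" using v U_rec by (auto simp: P_def)
    have mv: "(m, v) \<in> ?T\<^sup>*" using v(1) by (simp add: U_def)
    then have "U v \<subseteq> U m" by (auto simp: U_def)
    \<comment> \<open>With equal sets above them, \<open>m\<close> and \<open>v\<close> reach each
      other, which puts \<open>m\<close> on a tight cycle.\<close>
    with m(2)[OF \<open>P v\<close>] have "U v = U m" by (intro card_seteq) auto
    then have "(v, m) \<in> ?T\<^sup>*" by (auto simp: U_def)
    then have "(m, m) \<in> ?T\<^sup>+" using mv \<open>v \<noteq> m\<close>
      by (metis rtranclD trancl_rtrancl_trancl)
    then show False using m_rec by (auto simp: recurrent_def)
  qed
  have C_U: "x \<notin> U m" if "x \<in> C" for x using that C_rec U_rec by blast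
  have adj_m: "adj w x m" if x: "x \<in> C" for x
  proof -
    obtain x0 where x0: "x0 \<in> C" "adj w x0 m" using m(1) by (auto simp: P_def)
    have "(x0, x) \<in> ?T\<^sup>*" using x x0(1) by (auto simp: C_def intro: rtrancl_trans)
    then have "(\<Sum>z\<in>U m. w x0 z / \<mu> x0) \<le> (\<Sum>z\<in>U m. w x z / \<mu> x)"
      using C_U[OF x] U_up by (intro upset_rate_mono[OF \<alpha>]) auto
    moreover have "0 < (\<Sum>z\<in>U m. w x0 z / \<mu> x0)"
      unfolding rate_pos_iff using x0(2) by (auto simp: U_def)
    ultimately have "0 < (\<Sum>z\<in>U m. w x z / \<mu> x)" by simp
    then show ?thesis unfolding rate_pos_iff using only_m x by blast
  qed
  \<comment> \<open>The triangles spanned by \<open>m\<close> and the edges of the cycle make \<open>\<alpha> (m, \<cdot>)\<close> strictly increasing along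
    the cycle.\<close>
  define A where "A = Max ((\<lambda>x. \<alpha> $ (m, x)) ` C)"
  have "e \<in> C" by (simp add: C_def)
  then have "A \<in> (\<lambda>x. \<alpha> $ (m, x)) ` C" unfolding A_def by (intro Max_in) auto
  then obtain x where x: "x \<in> C" "\<alpha> $ (m, x) = A" by blast
  have "(x, x) \<in> ?T\<^sup>+"
    using x(1) e unfolding C_def by (metis (mono_tags, lifting) mem_Collect_eq rtrancl_trancl_trancl trancl_rtrancl_trancl)
  then obtain y where y: "(x, y) \<in> ?T" "(y, x) \<in> ?T\<^sup>*" by (meson tranclD)
  have "y \<in> C" using x(1) y by (auto simp: C_def intro: rtrancl_trans rtrancl_into_rtrancl)
  then have "\<alpha> $ (m, y) \<le> A" unfolding A_def by (intro Max_ge) auto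
  moreover have H1: "\<alpha> \<in> H1_M2 w \<mu> d" using \<alpha> by (simp add: lipschitz_harmonic_def)
  have xy: "adj w x y" "\<alpha> $ (x, y) = d x y" using y(1) by (auto simp: tight_def)
  have "\<alpha> $ (m, x) + \<alpha> $ (x, y) + \<alpha> $ (y, m) = 0"
    using adj_m x(1) \<open>y \<in> C\<close> xy(1) adj_sym by (intro H1_M2_triangle[OF H1]) auto
  then have "\<alpha> $ (m, y) = A + d x y"
    using H1_M2_antisym[OF H1, of y m] x(2) xy(2) by simp
  ultimately show False using tight_imp_pos[OF y(1)] by simp
qed

text \<open>The jump rate into the nonrecurrent vertices does not decrease along a tight path from
  \<open>x\<close> to a cycle, so a nonrecurrent neighbour of \<open>x\<close> would yield one of a
  vertex on the cycle.\<close>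

lemma recurrent_eq_UNIV:
  assumes \<alpha>: "lipschitz_harmonic \<alpha>" and "tight \<alpha> \<noteq> {}"
  shows "recurrent \<alpha> = UNIV"
proof (rule adj_closed_eq_UNIV)
  obtain e where "(e, e) \<in> (tight \<alpha>)\<^sup>+"
    using tight_not_acyclic[OF assms] by (auto simp: acyclic_def)
  then show "recurrent \<alpha> \<noteq> {}" by (auto simp: recurrent_def)
next
  fix x z assume "x \<in> recurrent \<alpha>" and xz: "adj w x z"
  then obtain e where e: "(x, e) \<in> (tight \<alpha>)\<^sup>*" "(e, e) \<in> (tight \<alpha>)\<^sup>+"
    by (auto simp: recurrent_def)
  show "z \<in> recurrent \<alpha>"
  proof (rule ccontr)
    assume z: "z \<notin> recurrent \<alpha>"
    have "(\<Sum>v\<in>- recurrent \<alpha>. w x v / \<mu> x) \<le> (\<Sum>v\<in>- recurrent \<alpha>. w e v / \<mu> e)"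
      using e recurrent_backward
      by (intro upset_rate_mono[OF \<alpha> _ e(1)]) (auto simp: recurrent_def intro: converse_rtrancl_into_rtrancl)
    moreover have "0 < (\<Sum>v\<in>- recurrent \<alpha>. w x v / \<mu> x)"
      unfolding rate_pos_iff using xz z by auto
    ultimately have "\<exists>v\<in>- recurrent \<alpha>. adj w e v"
      unfolding rate_pos_iff[symmetric] by simp
    then show False using neighbour_of_tight_cycle_recurrent[OF \<alpha> e(2)] by blast
  qed
qed

lemma tight_successor_exists:
  assumes "lipschitz_harmonic \<alpha>" "tight \<alpha> \<noteq> {}"
  obtains y where "(x, y) \<in> tight \<alpha>"
proof -
  have "x \<in> recurrent \<alpha>" using recurrent_eq_UNIV[OF assms] by simp
  then obtain e where "(x, e) \<in> (tight \<alpha>)\<^sup>*" "(e, e) \<in> (tight \<alpha>)\<^sup>+"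
    by (auto simp: recurrent_def)
  then show thesis using that by (metis converse_rtranclE tranclD)
qed

text \<open>The maximum \<open>M\<close> of \<open>\<alpha> $ (u, v) / d u v\<close> is taken over
  all edges of the graph. After division by \<open>M\<close>, both \<alpha> and its negative have
  tight edges, so each has a tight successor of the given vertex \<open>x\<close>.\<close>

lemma H1_M2_extremal_edges:
  assumes \<alpha>: "\<alpha> \<in> H1_M2 w \<mu> d" and "\<alpha> \<noteq> 0"
  shows "\<exists>M>0. (\<forall>y. adj w y x \<longrightarrow> \<bar>\<alpha> $ (x, y)\<bar> \<le> M * d x y) \<and>
    (\<exists>y. adj w y x \<and> \<alpha> $ (x, y) = M * d x y) \<and> (\<exists>y. adj w y x \<and> \<alpha> $ (x, y) = - (M * d x y))"
proof -
  define E where "E = {(u, v). adj w u v}"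
  define R where "R = (\<lambda>(u, v). \<alpha> $ (u, v) / d u v)"
  define M where "M = Max (R ` E)"
  have d_pos_E: "d u v > 0" if "adj w u v" for u v
    using that adj_irrefl by (intro d_pos) auto
  obtain u0 v0 where "\<alpha> $ (u0, v0) \<noteq> 0" using \<open>\<alpha> \<noteq> 0\<close> by (auto simp: vec_eq_iff)
  then obtain u v where uv: "\<alpha> $ (u, v) > 0"
    using H1_M2_antisym[OF \<alpha>, of v0 u0] by (metis neg_0_less_iff_less not_less_iff_gr_or_eq)
  then have adj_uv: "adj w u v" using H1_M2_nonadj[OF \<alpha>] by force
  then have "M \<in> R ` E" unfolding M_def by (intro Max_in) (auto simp: E_def)
  then obtain a b where ab: "adj w a b" "M = \<alpha> $ (a, b) / d a b" by (auto simp: E_def R_def)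
  have R_le: "\<alpha> $ (y, z) / d y z \<le> M" if "adj w y z" for y z
  proof -
    have "R (y, z) \<le> M" unfolding M_def using that by (intro Max_ge) (auto simp: E_def)
    then show ?thesis by (simp add: R_def)
  qed
  have M: "M > 0" using R_le[OF adj_uv] d_pos_E[OF adj_uv] uv by (smt (verit) divide_pos_pos)
  have le: "\<alpha> $ (y, z) \<le> M * d y z" if "adj w y z" for y z
    using R_le[OF that] d_pos_E[OF that] by (simp add: field_simps)
  have ab_eq: "\<alpha> $ (a, b) = M * d a b" using ab d_pos_E[OF ab(1)] by simp
  define \<beta> where "\<beta> = (1 / M) *\<^sub>R \<alpha>"
  have \<beta>: "\<beta> $ p = \<alpha> $ p / M" for p by (simp add: \<beta>_def)
  have H1: "\<beta> \<in> H1_M2 w \<mu> d" unfolding \<beta>_def by (intro subspace_scale subspace_H1_M2 \<alpha>)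
  have "lipschitz_harmonic \<beta>"
    unfolding lipschitz_harmonic_def using H1 le M by (auto simp: \<beta> field_simps)
  moreover have "(a, b) \<in> tight \<beta>" using ab(1) ab_eq M by (simp add: tight_def \<beta>)
  ultimately obtain y where y: "(x, y) \<in> tight \<beta>" using tight_successor_exists[of \<beta> x] by blast
  have "- \<beta> \<in> H1_M2 w \<mu> d" using H1 by (intro subspace_neg subspace_H1_M2)
  moreover have neg_le: "- \<alpha> $ (y, z) \<le> M * d y z" if "adj w y z" for y z
    using le[OF adj_sym[OF that]] H1_M2_antisym[OF \<alpha>, of z y] d_sym[of z y] by simp
  ultimately have "lipschitz_harmonic (- \<beta>)"
    unfolding lipschitz_harmonic_def using M by (auto simp: \<beta> field_simps)
  moreover have "(b, a) \<in> tight (- \<beta>)"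
    using adj_sym[OF ab(1)] ab_eq M H1_M2_antisym[OF \<alpha>, of b a] d_sym[of b a] by (simp add: tight_def \<beta>)
  ultimately obtain z where z: "(x, z) \<in> tight (- \<beta>)" using tight_successor_exists[of "- \<beta>" x] by blast
  have "adj w y x \<and> \<alpha> $ (x, y) = M * d x y"
    using y M adj_sym by (auto simp: tight_def \<beta> field_simps)
  moreover have "adj w z x \<and> \<alpha> $ (x, z) = - (M * d x z)"
  proof -
    have "- (\<alpha> $ (x, z) / M) = d x z" "adj w x z" using z by (simp_all add: tight_def \<beta>)
    then show ?thesis using M adj_sym by (auto simp: field_simps)
  qed
  moreover have "\<bar>\<alpha> $ (x, y)\<bar> \<le> M * d x y" if "adj w y x" for y
    using le[OF adj_sym[OF that]] neg_le[OF adj_sym[OF that]] by (simp add: abs_le_iff)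
  ultimately show ?thesis using M by blast
qed

end

theorem theorem3p6:
  fixes w :: "'v::finite \<Rightarrow> 'v \<Rightarrow> real" and \<mu> :: "'v \<Rightarrow> real" and d :: "'v \<Rightarrow> 'v \<Rightarrow> real"
  assumes "weighted_graph w \<mu> d"
    and "connected_graph w"
    and "nonneg_ollivier_curvature w \<mu> d"
  shows "real (betti1_M2 w \<mu> d) \<le> real (min_degree w) / 2"
proof -
  interpret nonneg_curved_graph w \<mu> d
    using assms by (simp add: nonneg_curved_graph_def nonneg_curved_graph_axioms_def)
  have "min_degree w \<in> range (vertex_degree w)" unfolding min_degree_def by (intro Min_in) auto
  then obtain x where x: "min_degree w = card {y. adj w y x}" by (auto simp: vertex_degree_def)
  \<comment> \<open>Inner products with these vectors are the functionals
    \<open>\<alpha> $ (x, y) / d x y\<close>, one for each neighbour of a vertex \<open>x\<close> of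
    minimal degree.\<close>
  define r :: "'v \<Rightarrow> real ^ ('v \<times> 'v)" where "r y = axis (x, y) (1 / d x y)" for y
  have r: "r y \<bullet> \<alpha> = \<alpha> $ (x, y) / d x y" for y \<alpha> by (simp add: r_def inner_axis')
  have "2 * dim (H1_M2 w \<mu> d) \<le> card {y. adj w y x}"
  proof (rule dim_le_half_of_symmetric_functionals[OF subspace_H1_M2, where r = r])
    fix \<alpha> assume "\<alpha> \<in> H1_M2 w \<mu> d" "\<alpha> \<noteq> 0"
    from H1_M2_extremal_edges[OF this, of x] obtain M where M: "M > 0"
      "\<forall>y. adj w y x \<longrightarrow> \<bar>\<alpha> $ (x, y)\<bar> \<le> M * d x y"
      "\<exists>y. adj w y x \<and> \<alpha> $ (x, y) = M * d x y" "\<exists>y. adj w y x \<and> \<alpha> $ (x, y) = - (M * d x y)"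
      by blast
    have "d x y > 0" if "adj w y x" for y using that adj_irrefl by (intro d_pos) auto
    then show "\<exists>M>0. (\<forall>y\<in>{y. adj w y x}. \<bar>r y \<bullet> \<alpha>\<bar> \<le> M) \<and>
      (\<exists>y\<in>{y. adj w y x}. r y \<bullet> \<alpha> = M) \<and> (\<exists>y\<in>{y. adj w y x}. r y \<bullet> \<alpha> = - M)"
      using M by (intro exI[of _ M]) (fastforce simp: r field_simps abs_divide)
  qed simp
  then show ?thesis by (simp add: betti1_M2_def x)
qed

end
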